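(* For every integer $k\ge 3$ there is no largest element in $\mathtt{A}_k$; that is, there is no $P\in\mathtt{A}_k$ such that $Q\le P$ on $A_k$ for all $Q\in\mathtt{A}_k$.
   Context: Let $A_k=\{(p_1,\dots,p_{k-1})\in\mathbb{R}^{k-1}: p_l\ge 0 \text{ for } 1\le l\le k-1,\ \sum_{l=1}^{k-1}p_l\le 1\}$. For $(p_1,\dots,p_{k-1})\in A_k$ put $p_k=1-\sum_{l=1}^{k-1}p_l$, let $(X_i)_{i\ge 1}$ be i.i.d. with $\mathbb{P}(X_1=l)=p_l$ for $1\le l\le k$, let $S_0=0$, $S_n=\sum_{i=1}^nX_i$, and let $u_n=\mathbb{P}(n\in\{S_0,S_1,\dots\})$ be the renewal masses. Thus $u_0=1$ and $u_n=\sum_{l=1}^{\min\{n,k\}}p_lu_{n-l}$ for $n\ge1$. Let $m_k=m_k(p_1,\dots,p_{k-1})=\min_{l\ge1}u_l$, viewed as a function on $A_k$. Let $\mathcal{P}_k$ be the set of real polynomials in $k-1$ variables, and let $\deg(P)$ denote the total degree of $P$. Define $$\mathtt{A}_k=\{P\in\mathcal{P}_k:\ \deg(P)\le k-1,\ P\le m_k\text{ on }A_k\}.$$ *)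

theory Defs
  imports "HOL-Probability.Probability" "HOL-Library.Poly_Mapping"
begin

section \<open>Renewal masses\<close>

text \<open>Points of \<open>\<real>\<^bsup>k-1\<^esup>\<close> are the functions on the index set \<open>{1..k - 1}\<close>, extended by
  \<^const>\<open>undefined\<close> outside (\<^const>\<open>PiE\<close>).\<close>

definition A_simplex :: "nat \<Rightarrow> (nat \<Rightarrow> real) set" where
  "A_simplex k = {p \<in> {1..k - 1} \<rightarrow>\<^sub>E UNIV. (\<forall>l\<in>{1..k - 1}. 0 \<le> p l) \<and> (\<Sum>l = 1..k - 1. p l) \<le> 1}"

definition step_mass :: "nat \<Rightarrow> (nat \<Rightarrow> real) \<Rightarrow> nat \<Rightarrow> real" where
  "step_mass k p l =
    (if 1 \<le> l \<and> l \<le> k - 1 then p l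
     else if l = k then 1 - (\<Sum>j = 1..k - 1. p j)
     else 0)"

text \<open>Meaningful only if \<open>step_mass k p\<close> is a probability mass function, which holds for
  \<open>p \<in> A_simplex k\<close> and \<open>k \<ge> 1\<close>; see \<open>pmf_step_pmf\<close> below.\<close>

definition step_pmf :: "nat \<Rightarrow> (nat \<Rightarrow> real) \<Rightarrow> nat pmf" where
  "step_pmf k p = embed_pmf (step_mass k p)"

text \<open>The canonical i.i.d. sequence: under this measure, the coordinate \<open>\<omega> i\<close> is \<open>X\<^bsub>i+1\<^esub>\<close>,
  so that \<open>S\<^sub>m = (\<Sum>i<m. \<omega> i)\<close>.\<close>

definition steps_measure :: "nat \<Rightarrow> (nat \<Rightarrow> real) \<Rightarrow> (nat \<Rightarrow> nat) measure" where
  "steps_measure k p = (\<Pi>\<^sub>M i\<in>UNIV. measure_pmf (step_pmf k p))"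

definition partial_sum :: "(nat \<Rightarrow> nat) \<Rightarrow> nat \<Rightarrow> nat" where
  "partial_sum \<omega> m = (\<Sum>i<m. \<omega> i)"

definition renewal_mass :: "nat \<Rightarrow> (nat \<Rightarrow> real) \<Rightarrow> nat \<Rightarrow> real" where
  "renewal_mass k p n =
    measure (steps_measure k p) {\<omega> \<in> space (steps_measure k p). n \<in> range (partial_sum \<omega>)}"

text \<open>The minimum of an infinite family is written as an infimum; the family is bounded below by
  \<open>0\<close>, so a minimum, where it is attained, equals this infimum.  It is attained for all \<open>p\<close> in
  \<open>A_simplex k\<close>, because suitable convex combinations of consecutive renewal masses are constantly
  the reciprocal mean \<open>1 / E X\<^sub>1\<close>, and the renewal masses tend to that value in the aperiodic case
  (in the periodic case some mass is \<open>0\<close>).\<close>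

definition min_mass :: "nat \<Rightarrow> (nat \<Rightarrow> real) \<Rightarrow> real" where
  "min_mass k p = (INF l\<in>{1..}. renewal_mass k p l)"


section \<open>Real polynomials in finitely many variables\<close>

text \<open>A monomial is a finitely supported map from variables to exponents, and a polynomial is a
  finitely supported map from monomials to coefficients.\<close>

type_synonym real_mpoly = "(nat \<Rightarrow>\<^sub>0 nat) \<Rightarrow>\<^sub>0 real"

definition mpoly_eval :: "real_mpoly \<Rightarrow> (nat \<Rightarrow> real) \<Rightarrow> real" where
  "mpoly_eval P x =
    (\<Sum>m\<in>Poly_Mapping.keys P. Poly_Mapping.lookup P m *
      (\<Prod>i\<in>Poly_Mapping.keys m. x i ^ Poly_Mapping.lookup m i))"

definition monomial_degree :: "(nat \<Rightarrow>\<^sub>0 nat) \<Rightarrow> nat" where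
  "monomial_degree m = (\<Sum>i\<in>Poly_Mapping.keys m. Poly_Mapping.lookup m i)"

text \<open>The zero polynomial gets total degree \<open>0\<close>.\<close>

definition total_degree :: "real_mpoly \<Rightarrow> nat" where
  "total_degree P = Max (insert 0 (monomial_degree ` Poly_Mapping.keys P))"

text \<open>Polynomials in the variables with indices \<open>1, \<dots>, k - 1\<close>.\<close>

definition polys :: "nat \<Rightarrow> real_mpoly set" where
  "polys k = {P. \<forall>m\<in>Poly_Mapping.keys P. Poly_Mapping.keys m \<subseteq> {1..k - 1}}"

definition minorants :: "nat \<Rightarrow> real_mpoly set" where
  "minorants k =
    {P \<in> polys k. total_degree P \<le> k - 1 \<and> (\<forall>p\<in>A_simplex k. mpoly_eval P p \<le> min_mass k p)}"


section \<open>The step distribution and the renewal recursion\<close>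

lemma step_mass_nonneg:
  assumes "p \<in> A_simplex k"
  shows "0 \<le> step_mass k p l"
  using assms by (auto simp: step_mass_def A_simplex_def)

lemma sum_step_mass:
  assumes "1 \<le> k"
  shows "(\<Sum>l = 1..k. step_mass k p l) = 1"
proof -
  have "{1..k} = insert k {1..k - 1}" "k \<notin> {1..k - 1}" using assms by auto
  then have "(\<Sum>l = 1..k. step_mass k p l) = step_mass k p k + (\<Sum>l = 1..k - 1. step_mass k p l)"
    by simp
  also have "(\<Sum>l = 1..k - 1. step_mass k p l) = (\<Sum>l = 1..k - 1. p l)"
    by (intro sum.cong) (auto simp: step_mass_def)
  also have "step_mass k p k = 1 - (\<Sum>l = 1..k - 1. p l)"
    using assms by (auto simp: step_mass_def)
  finally show ?thesis by simp
qed

lemma step_mass_eq_0: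
  assumes "1 \<le> k" "l \<notin> {1..k}"
  shows "step_mass k p l = 0"
  using assms by (auto simp: step_mass_def)

lemma pmf_step_pmf:
  assumes "1 \<le> k" "p \<in> A_simplex k"
  shows "pmf (step_pmf k p) l = step_mass k p l"
  unfolding step_pmf_def
proof (rule pmf_embed_pmf)
  show "0 \<le> step_mass k p x" for x by (rule step_mass_nonneg[OF assms(2)])
  have "(\<integral>\<^sup>+x. ennreal (step_mass k p x) \<partial>count_space UNIV) = (\<Sum>l = 1..k. ennreal (step_mass k p l))"
    by (rule nn_integral_count_space') (auto simp: step_mass_eq_0[OF assms(1)])
  also have "\<dots> = ennreal (\<Sum>l = 1..k. step_mass k p l)"
    by (rule sum_ennreal) (rule step_mass_nonneg[OF assms(2)])
  finally show "(\<integral>\<^sup>+x. ennreal (step_mass k p x) \<partial>count_space UNIV) = 1"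
    using sum_step_mass[OF assms(1)] by simp
qed

lemma renewal_event_sets:
  "{\<omega> \<in> space (steps_measure k p). n \<in> range (partial_sum \<omega>)} \<in> sets (steps_measure k p)"
proof -
  have "Measurable.pred (steps_measure k p) (\<lambda>\<omega>. \<exists>m. partial_sum \<omega> m = n)"
    unfolding steps_measure_def partial_sum_def by measurable
  moreover have "{\<omega> \<in> space (steps_measure k p). n \<in> range (partial_sum \<omega>)} =
      {\<omega> \<in> space (steps_measure k p). \<exists>m. partial_sum \<omega> m = n}"
    by auto
  ultimately show ?thesis by (simp add: pred_def)
qed

lemma space_steps_measure [simp]: "space (steps_measure k p) = UNIV"
  by (simp add: steps_measure_def space_PiM PiE_def)

lemma prob_space_steps_measure: "prob_space (steps_measure k p)"
  unfolding steps_measure_def by (intro prob_space_PiM measure_pmf.prob_space_axioms)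

lemma renewal_mass_0: "renewal_mass k p 0 = 1"
proof -
  have "0 \<in> range (partial_sum \<omega>)" for \<omega>
    by (rule range_eqI[of _ _ 0]) (simp add: partial_sum_def)
  then show ?thesis
    using prob_space.prob_space[OF prob_space_steps_measure, of k p]
    by (simp add: renewal_mass_def)
qed

lemma partial_sum_case_nat:
  assumes "1 \<le> n"
  shows "n \<in> range (partial_sum (case_nat s \<omega>)) \<longleftrightarrow> s \<le> n \<and> n - s \<in> range (partial_sum \<omega>)"
proof -
  have *: "partial_sum (case_nat s \<omega>) (Suc m) = s + partial_sum \<omega> m" for m
    unfolding partial_sum_def by (simp add: sum.lessThan_Suc_shift del: sum.lessThan_Suc)
  have **: "partial_sum (case_nat s \<omega>) 0 = 0" by (simp add: partial_sum_def)
  have "n \<in> range (partial_sum (case_nat s \<omega>)) \<longleftrightarrow> (\<exists>m. n = partial_sum (case_nat s \<omega>) (Suc m))"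
    using ** assms by (metis not_one_le_zero rangeE range_eqI not0_implies_Suc)
  also have "\<dots> \<longleftrightarrow> (\<exists>m. s \<le> n \<and> n - s = partial_sum \<omega> m)"
    unfolding * by (intro ex_cong1) auto
  finally show ?thesis by auto
qed

lemma renewal_mass_rec:
  assumes k: "1 \<le> k" and p: "p \<in> A_simplex k" and n: "1 \<le> n"
  shows "renewal_mass k p n = (\<Sum>l = 1..min n k. step_mass k p l * renewal_mass k p (n - l))"
proof -
  let ?M = "measure_pmf (step_pmf k p)"
  let ?S = "steps_measure k p"
  let ?E = "\<lambda>n. {\<omega> \<in> space ?S. n \<in> range (partial_sum \<omega>)}"
  let ?f = "\<lambda>(s, \<omega>). case_nat s \<omega> :: nat \<Rightarrow> nat"
  interpret seq: sequence_space ?M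
    by standard
  interpret S: prob_space ?S by (rule prob_space_steps_measure)
  have S_eq: "seq.S = ?S" by (simp add: steps_measure_def)
  have f [measurable]: "?f \<in> measurable (?M \<Otimes>\<^sub>M ?S) ?S"
    unfolding S_eq[symmetric] by measurable
  have emeasure_E: "emeasure ?S (?E m) = ennreal (renewal_mass k p m)" for m
    by (simp add: renewal_mass_def S.emeasure_eq_measure)
  have u_nonneg: "0 \<le> renewal_mass k p m" for m by (simp add: renewal_mass_def)
  have "emeasure ?S (?E n) = emeasure (distr (?M \<Otimes>\<^sub>M ?S) ?S ?f) (?E n)"
    using seq.PiM_iter unfolding S_eq by simp
  also have "\<dots> = emeasure (?M \<Otimes>\<^sub>M ?S) (?f -` ?E n \<inter> space (?M \<Otimes>\<^sub>M ?S))"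
    by (rule emeasure_distr[OF f renewal_event_sets])
  also have "\<dots> = (\<integral>\<^sup>+ s. emeasure ?S (Pair s -` (?f -` ?E n \<inter> space (?M \<Otimes>\<^sub>M ?S))) \<partial>?M)"
    by (rule S.emeasure_pair_measure_alt) (rule measurable_sets[OF f renewal_event_sets])
  also have "\<dots> = (\<integral>\<^sup>+ s. (if s \<le> n then ennreal (renewal_mass k p (n - s)) else 0) \<partial>?M)"
  proof (intro nn_integral_cong)
    fix s
    have "Pair s -` (?f -` ?E n \<inter> space (?M \<Otimes>\<^sub>M ?S)) = (if s \<le> n then ?E (n - s) else {})"
      using partial_sum_case_nat[OF n, of s] by (auto simp: space_pair_measure)
    then show "emeasure ?S (Pair s -` (?f -` ?E n \<inter> space (?M \<Otimes>\<^sub>M ?S))) =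
        (if s \<le> n then ennreal (renewal_mass k p (n - s)) else 0)"
      using emeasure_E by (simp split: if_splits)
  qed
  also have "\<dots> = (\<integral>\<^sup>+ s. ennreal (step_mass k p s) *
      (if s \<le> n then ennreal (renewal_mass k p (n - s)) else 0) \<partial>count_space UNIV)"
    unfolding nn_integral_measure_pmf pmf_step_pmf[OF k p] ..
  also have "\<dots> = (\<Sum>s = 1..min n k. ennreal (step_mass k p s) *
      (if s \<le> n then ennreal (renewal_mass k p (n - s)) else 0))"
  proof (rule nn_integral_count_space')
    fix x assume "x \<notin> {1..min n k}"
    then show "ennreal (step_mass k p x) *
      (if x \<le> n then ennreal (renewal_mass k p (n - x)) else 0) = 0"
      using step_mass_eq_0[OF k, of x p] by auto
  qed auto
  also have "\<dots> = (\<Sum>s = 1..min n k. ennreal (step_mass k p s * renewal_mass k p (n - s)))"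
    by (intro sum.cong) (auto simp: ennreal_mult step_mass_nonneg[OF p] u_nonneg)
  also have "\<dots> = ennreal (\<Sum>s = 1..min n k. step_mass k p s * renewal_mass k p (n - s))"
    by (intro sum_ennreal mult_nonneg_nonneg step_mass_nonneg[OF p] u_nonneg)
  finally show ?thesis
    unfolding emeasure_E
    by (subst (asm) ennreal_inj) (auto intro!: sum_nonneg mult_nonneg_nonneg step_mass_nonneg[OF p] u_nonneg)
qed

end

theory Submission
  imports Defs
begin

text \<open>
  The theorem is true because of the behaviour of \<open>m\<^sub>k\<close> near the facet \<open>p\<^sub>1 = 0\<close>, on which
  \<open>m\<^sub>k \<le> u\<^sub>1 = p\<^sub>1\<close> vanishes.  Consider the points \<open>c\<^sub>s = (0, s, 1 - s, 0, \<dots>)\<close> of this facet.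
  For \<open>0 < s < 1\<close> the step sizes \<open>2\<close> and \<open>3\<close> both have positive mass, and all masses \<open>u\<^sub>n\<close> with
  \<open>n \<ge> 2\<close> are bounded away from \<open>0\<close> near \<open>c\<^sub>s\<close>, uniformly in \<open>n\<close>.  Hence \<open>m\<^sub>k = p\<^sub>1\<close> near \<open>c\<^sub>s\<close>, and the
  quadratic polynomial \<open>p\<^sub>1 - K |p - c\<^sub>s|\<^sup>2\<close> is a minorant once \<open>K\<close> is large
  (\<open>peak_poly_in_minorants\<close>).  A largest minorant \<open>P\<close> would therefore vanish at \<open>c\<^sub>s\<close> and have
  slope at least \<open>1\<close> there when \<open>p\<^sub>1\<close> increases at the expense of \<open>p\<^sub>3\<close>.  This slope is continuous
  in \<open>s\<close>, since \<open>P\<close> is a polynomial, so it is also at least \<open>1\<close> at \<open>c\<^sub>0\<close>.  But at \<open>p\<^sub>2 = 0\<close> the bound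
  \<open>P \<le> u\<^sub>2 = p\<^sub>1\<^sup>2 + p\<^sub>2\<close> becomes \<open>P \<le> p\<^sub>1\<^sup>2\<close>, which forces slope at most \<open>0\<close>.

  The obstruction is that \<open>K\<close> has to grow without bound as \<open>s\<close> tends to \<open>0\<close>, so that the
  minorants themselves do not converge to one at \<open>c\<^sub>0\<close>.  The assumption \<open>k \<ge> 3\<close> gives
  \<open>2 \<le> k - 1\<close>, which admits quadratic polynomials.
\<close>

section \<open>Polynomial evaluation\<close>

lemma mpoly_eval_superset:
  assumes "finite S" "Poly_Mapping.keys P \<subseteq> S"
  shows "mpoly_eval P x = (\<Sum>m\<in>S. Poly_Mapping.lookup P m *
      (\<Prod>i\<in>Poly_Mapping.keys m. x i ^ Poly_Mapping.lookup m i))"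
  unfolding mpoly_eval_def using assms
  by (intro sum.mono_neutral_left) (auto simp: in_keys_iff)

lemma mpoly_eval_0 [simp]: "mpoly_eval 0 x = 0"
  by (simp add: mpoly_eval_def)

lemma mpoly_eval_add: "mpoly_eval (P + Q) x = mpoly_eval P x + mpoly_eval Q x"
proof -
  let ?S = "Poly_Mapping.keys P \<union> Poly_Mapping.keys Q"
  have "Poly_Mapping.keys (P + Q) \<subseteq> ?S" by (rule Poly_Mapping.keys_add)
  then show ?thesis
    by (simp add: mpoly_eval_superset[of ?S] lookup_add distrib_right sum.distrib)
qed

lemma mpoly_eval_sum: "mpoly_eval (sum f A) x = (\<Sum>a\<in>A. mpoly_eval (f a) x)"
  by (induction A rule: infinite_finite_induct) (auto simp: mpoly_eval_add)

lemma mpoly_eval_single: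
  "mpoly_eval (Poly_Mapping.single m c) x =
    c * (\<Prod>i\<in>Poly_Mapping.keys m. x i ^ Poly_Mapping.lookup m i)"
  by (simp add: mpoly_eval_def)

definition polys_upto :: "nat \<Rightarrow> nat \<Rightarrow> real_mpoly set" where
  "polys_upto k d = {P \<in> polys k. total_degree P \<le> d}"

lemma polys_upto_iff:
  "P \<in> polys_upto k d \<longleftrightarrow>
    (\<forall>m\<in>Poly_Mapping.keys P. Poly_Mapping.keys m \<subseteq> {1..k - 1} \<and> monomial_degree m \<le> d)"
  by (auto simp: polys_upto_def polys_def total_degree_def)

lemma polys_upto_add: "P \<in> polys_upto k d \<Longrightarrow> Q \<in> polys_upto k d \<Longrightarrow> P + Q \<in> polys_upto k d"
  using Poly_Mapping.keys_add[of P Q] unfolding polys_upto_iff by blast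

lemma polys_upto_0: "0 \<in> polys_upto k d"
  by (simp add: polys_upto_iff)

lemma polys_upto_sum: "(\<And>a. a \<in> A \<Longrightarrow> f a \<in> polys_upto k d) \<Longrightarrow> sum f A \<in> polys_upto k d"
  by (induction A rule: infinite_finite_induct) (auto intro: polys_upto_add polys_upto_0)

lemma polys_upto_single_power:
  assumes "l \<in> {1..k - 1}" "e \<le> d"
  shows "Poly_Mapping.single (Poly_Mapping.single l e) c \<in> polys_upto k d"
  using assms by (auto simp: polys_upto_iff monomial_degree_def)

lemma minorants_iff:
  "P \<in> minorants k \<longleftrightarrow> P \<in> polys_upto k (k - 1) \<and> (\<forall>p\<in>A_simplex k. mpoly_eval P p \<le> min_mass k p)"
  by (auto simp: minorants_def polys_upto_def)


section \<open>Bounds for the renewal masses\<close>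

lemma renewal_mass_nonneg: "0 \<le> renewal_mass k p n"
  by (simp add: renewal_mass_def)

lemma renewal_mass_1:
  assumes "3 \<le> k" "p \<in> A_simplex k"
  shows "renewal_mass k p 1 = p 1"
  using renewal_mass_rec[of k p 1] assms by (simp add: step_mass_def renewal_mass_0)

lemma renewal_mass_2:
  assumes "3 \<le> k" "p \<in> A_simplex k"
  shows "renewal_mass k p 2 = p 1 ^ 2 + p 2"
proof -
  have "{1..min 2 k} = {1, 2}" using assms by auto
  then show ?thesis
    using renewal_mass_rec[of k p 2] assms renewal_mass_1[OF assms]
    by (simp add: step_mass_def renewal_mass_0 power2_eq_square)
qed

lemma min_mass_le: "1 \<le> n \<Longrightarrow> min_mass k p \<le> renewal_mass k p n"
  unfolding min_mass_def
  by (intro cINF_lower bdd_belowI2[where m = 0]) (auto simp: renewal_mass_nonneg)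

lemma min_mass_ge: "(\<And>n. 1 \<le> n \<Longrightarrow> a \<le> renewal_mass k p n) \<Longrightarrow> a \<le> min_mass k p"
  unfolding min_mass_def by (intro cINF_greatest) auto

lemma renewal_mass_ge_step:
  assumes "1 \<le> k" "p \<in> A_simplex k" "l \<in> {1..min n k}"
  shows "step_mass k p l * renewal_mass k p (n - l) \<le> renewal_mass k p n"
proof -
  have "step_mass k p l * renewal_mass k p (n - l)
      \<le> (\<Sum>l = 1..min n k. step_mass k p l * renewal_mass k p (n - l))"
    by (rule member_le_sum[OF assms(3)])
      (auto simp: step_mass_nonneg[OF assms(2)] renewal_mass_nonneg)
  then show ?thesis using renewal_mass_rec[of k p n] assms by auto
qed

text \<open>Each mass with index above \<open>k\<close> is a convex combination of the \<open>k\<close> preceding ones.  A lower bound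
  on the \<open>k\<close> consecutive masses with indices \<open>2, \<dots>, k + 1\<close> therefore persists, and there it
  suffices to reach the index by steps \<open>2\<close> and at most one step \<open>3\<close>.\<close>

lemma renewal_mass_uniform_lower_bound:
  assumes k: "3 \<le> k" and p: "p \<in> A_simplex k" and \<alpha>: "0 \<le> \<alpha>" "\<alpha> \<le> 1"
    and steps: "\<alpha> \<le> step_mass k p 2" "\<alpha> \<le> step_mass k p 3"
    and n: "2 \<le> n"
  shows "\<alpha> ^ (k + 1) \<le> renewal_mass k p n"
proof -
  have pow: "\<alpha> ^ n \<le> renewal_mass k p n" if "2 \<le> n" for n
    using that
  proof (induction n rule: less_induct)
    case (less n)
    have drop1: "\<alpha> ^ n \<le> \<alpha> ^ 1" using less.prems \<alpha> by (intro power_decreasing) auto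
    consider "n = 2" | "n = 3" | "4 \<le> n" using less.prems by linarith
    then show ?case
    proof cases
      case 1
      then show ?thesis
        using renewal_mass_ge_step[of k p 2 n] k p steps drop1 by (simp add: renewal_mass_0)
    next
      case 2
      then show ?thesis
        using renewal_mass_ge_step[of k p 3 n] k p steps drop1 by (simp add: renewal_mass_0)
    next
      case 3
      have "\<alpha> ^ n \<le> \<alpha> ^ Suc (n - 2)" using 3 \<alpha> by (intro power_decreasing) auto
      also have "\<dots> \<le> step_mass k p 2 * renewal_mass k p (n - 2)"
        using less.IH[of "n - 2"] 3 steps \<alpha> step_mass_nonneg[OF p]
        by (simp add: mult_mono)
      also have "\<dots> \<le> renewal_mass k p n"
        using renewal_mass_ge_step[of k p 2 n] k p 3 by simp
      finally show ?thesis .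
    qed
  qed
  from n show ?thesis
  proof (induction n rule: less_induct)
    case (less n)
    show ?case
    proof (cases "n \<le> k + 1")
      case True
      then have "\<alpha> ^ (k + 1) \<le> \<alpha> ^ n" using \<alpha> by (intro power_decreasing) auto
      then show ?thesis using pow[OF less.prems] by linarith
    next
      case False
      have "\<alpha> ^ (k + 1) = (\<Sum>l = 1..k. step_mass k p l * \<alpha> ^ (k + 1))"
        using sum_step_mass[of k p] k by (simp add: sum_distrib_right[symmetric] del: power_Suc)
      also have "\<dots> \<le> (\<Sum>l = 1..k. step_mass k p l * renewal_mass k p (n - l))"
        using False by (intro sum_mono mult_left_mono less.IH step_mass_nonneg[OF p]) auto
      also have "\<dots> = renewal_mass k p n"
        using renewal_mass_rec[of k p n] k p False by (simp add: min_def)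
      finally show ?thesis .
    qed
  qed
qed


section \<open>Quadratic minorants at the facet\<close>

text \<open>The third step size receives the remaining mass.  For \<open>k = 3\<close> it is not a coordinate, and the
  restriction leaves it implicit.\<close>

definition near_facet :: "nat \<Rightarrow> real \<Rightarrow> real \<Rightarrow> nat \<Rightarrow> real" where
  "near_facet k t s = (\<lambda>i\<in>{1..k - 1}. if i = 1 then t else if i = 2 then s
    else if i = 3 then 1 - t - s else 0)"

lemma near_facet_in_A_simplex:
  assumes "3 \<le> k" "0 \<le> t" "0 \<le> s" "t + s \<le> 1"
  shows "near_facet k t s \<in> A_simplex k"
proof -
  let ?f = "\<lambda>i::nat. if i = 1 then t else if i = 2 then s else if i = 3 then 1 - t - s else 0"
  have "(\<Sum>i = 1..k - 1. near_facet k t s i) = (\<Sum>i = 1..k - 1. ?f i)"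
    by (intro sum.cong) (auto simp: near_facet_def)
  also have "\<dots> \<le> (\<Sum>i = 1..k. ?f i)"
    using assms by (intro sum_mono2) auto
  also have "\<dots> = (\<Sum>i\<in>{1, 2, 3}. ?f i)"
    using assms by (intro sum.mono_neutral_right) auto
  also have "\<dots> = 1" by simp
  finally show ?thesis using assms by (auto simp: A_simplex_def near_facet_def)
qed

text \<open>The expansion of \<open>p\<^sub>1 - K |p - c|\<^sup>2\<close> into monomials.\<close>

definition peak_poly :: "nat \<Rightarrow> real \<Rightarrow> (nat \<Rightarrow> real) \<Rightarrow> real_mpoly" where
  "peak_poly k K c = Poly_Mapping.single (Poly_Mapping.single 1 1) 1 +
    (\<Sum>l\<in>{1..k - 1}. Poly_Mapping.single (Poly_Mapping.single l 2) (- K) +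
      Poly_Mapping.single (Poly_Mapping.single l 1) (2 * K * c l) +
      Poly_Mapping.single (Poly_Mapping.single l 0) (- K * (c l)\<^sup>2))"

lemma mpoly_eval_peak_poly:
  "mpoly_eval (peak_poly k K c) p = p 1 - K * (\<Sum>l\<in>{1..k - 1}. (p l - c l)\<^sup>2)"
proof -
  have "mpoly_eval (peak_poly k K c) p =
      p 1 + (\<Sum>l\<in>{1..k - 1}. - K * (p l)\<^sup>2 + 2 * K * c l * p l + - K * (c l)\<^sup>2)"
    unfolding peak_poly_def by (simp add: mpoly_eval_add mpoly_eval_sum mpoly_eval_single)
  also have "(\<Sum>l\<in>{1..k - 1}. - K * (p l)\<^sup>2 + 2 * K * c l * p l + - K * (c l)\<^sup>2) =
      (\<Sum>l\<in>{1..k - 1}. - K * (p l - c l)\<^sup>2)"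
    by (intro sum.cong) (auto simp: power2_eq_square algebra_simps)
  also have "\<dots> = - K * (\<Sum>l\<in>{1..k - 1}. (p l - c l)\<^sup>2)"
    by (simp only: sum_distrib_left)
  finally show ?thesis by simp
qed

lemma peak_poly_in_polys_upto:
  assumes "3 \<le> k"
  shows "peak_poly k K c \<in> polys_upto k (k - 1)"
  unfolding peak_poly_def using assms
  by (intro polys_upto_add polys_upto_sum polys_upto_single_power) auto

text \<open>Close to the facet point, the masses \<open>u\<^sub>n\<close> with \<open>n \<ge> 2\<close> exceed \<open>p\<^sub>1\<close>, so \<open>m\<^sub>k = p\<^sub>1\<close> there; away from
  it, a large \<open>K\<close> makes the polynomial at most \<open>0 \<le> m\<^sub>k\<close>.\<close>

lemma peak_poly_in_minorants:
  assumes k: "3 \<le> k" and s: "0 < s" "s < 1"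
  obtains K where "0 \<le> K" "peak_poly k K (near_facet k 0 s) \<in> minorants k"
proof -
  define c where "c = near_facet k 0 s"
  define \<alpha> where "\<alpha> = min s (1 - s) / 2"
  \<comment> \<open>The radius is the uniform lower bound on the masses that \<open>\<alpha>\<close> provides.\<close>
  define \<delta> where "\<delta> = \<alpha> ^ (k + 1)"
  have \<alpha>: "0 < \<alpha>" "\<alpha> \<le> 1 / 2" "2 * \<alpha> \<le> s" "2 * \<alpha> \<le> 1 - s"
    using s by (auto simp: \<alpha>_def min_def)
  have "\<delta> \<le> \<alpha> ^ 2" unfolding \<delta>_def using \<alpha> k by (intro power_decreasing) auto
  also have "\<alpha> ^ 2 \<le> \<alpha> / 2" using \<alpha> mult_left_mono[of \<alpha> "1 / 2" \<alpha>] by (simp add: power2_eq_square)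
  finally have \<delta>_le: "2 * \<delta> \<le> \<alpha>" by simp
  have \<delta>_pos: "0 < \<delta>" using \<alpha> by (simp add: \<delta>_def)
  have "mpoly_eval (peak_poly k (1 / \<delta>\<^sup>2) c) p \<le> min_mass k p" if p: "p \<in> A_simplex k" for p
  proof -
    let ?d = "\<Sum>l\<in>{1..k - 1}. (p l - c l)\<^sup>2"
    have p_nonneg: "\<And>l. l \<in> {1..k - 1} \<Longrightarrow> 0 \<le> p l" and p_sum: "(\<Sum>l = 1..k - 1. p l) \<le> 1"
      using p by (auto simp: A_simplex_def)
    show ?thesis
    proof (cases "\<forall>l\<in>{1..k - 1}. \<bar>p l - c l\<bar> \<le> \<delta>")
      case True
      have close: "\<bar>p 1\<bar> \<le> \<delta>" "\<bar>p 2 - s\<bar> \<le> \<delta>"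
        using k True[rule_format, of 1] True[rule_format, of 2] by (auto simp: c_def near_facet_def)
      have "step_mass k p 2 = p 2" using k by (auto simp: step_mass_def)
      then have step2: "\<alpha> \<le> step_mass k p 2" using close \<alpha> \<delta>_le by linarith
      have step3: "\<alpha> \<le> step_mass k p 3"
      proof (cases "k = 3")
        \<comment> \<open>Here \<open>p\<^sub>3 = 1 - p\<^sub>1 - p\<^sub>2\<close>, which accumulates two errors of size \<open>\<delta>\<close>.\<close>
        case True
        then have "{1..k - 1} = {1, 2}" by auto
        then have "step_mass k p 3 = 1 - p 1 - p 2" using True by (simp add: step_mass_def)
        then show ?thesis using close \<alpha> \<delta>_le by linarith
      next
        case False
        then have "\<bar>p 3 - (1 - s)\<bar> \<le> \<delta>"
          using k True[rule_format, of 3] by (auto simp: c_def near_facet_def)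
        moreover have "step_mass k p 3 = p 3" using False k by (auto simp: step_mass_def)
        ultimately show ?thesis using \<alpha> \<delta>_le by linarith
      qed
      have "mpoly_eval (peak_poly k (1 / \<delta>\<^sup>2) c) p \<le> p 1"
        by (simp add: mpoly_eval_peak_poly sum_nonneg)
      also have "p 1 \<le> min_mass k p"
      proof (rule min_mass_ge)
        fix n :: nat assume "1 \<le> n"
        show "p 1 \<le> renewal_mass k p n"
        proof (cases "n = 1")
          case True
          then show ?thesis using renewal_mass_1[OF k p] by simp
        next
          case False
          then have "\<delta> \<le> renewal_mass k p n"
            unfolding \<delta>_def using \<open>1 \<le> n\<close> \<alpha>
            by (intro renewal_mass_uniform_lower_bound k p step2 step3) auto
          then show ?thesis using close by linarith
        qed
      qed
      finally show ?thesis .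
    next
      case False
      then obtain l where l: "l \<in> {1..k - 1}" "\<delta> < \<bar>p l - c l\<bar>" by force
      have "\<delta>\<^sup>2 \<le> (p l - c l)\<^sup>2"
        using l(2) \<delta>_pos by (simp add: abs_le_square_iff[symmetric])
      also have "\<dots> \<le> ?d" using l(1) by (intro member_le_sum) auto
      finally have "1 \<le> 1 / \<delta>\<^sup>2 * ?d" using \<delta>_pos by (simp add: field_simps)
      moreover have "p 1 \<le> (\<Sum>l = 1..k - 1. p l)"
        using k p_nonneg by (intro member_le_sum) auto
      ultimately have "mpoly_eval (peak_poly k (1 / \<delta>\<^sup>2) c) p \<le> 0"
        using p_sum unfolding mpoly_eval_peak_poly by linarith
      also have "0 \<le> min_mass k p" by (intro min_mass_ge renewal_mass_nonneg)
      finally show ?thesis .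
    qed
  qed
  then have "peak_poly k (1 / \<delta>\<^sup>2) c \<in> minorants k"
    using peak_poly_in_polys_upto[OF k] by (simp add: minorants_iff)
  then show thesis using that[of "1 / \<delta>\<^sup>2"] by (simp add: c_def)
qed

lemma mpoly_eval_peak_poly_near_facet:
  assumes "3 \<le> k" "0 \<le> K"
  shows "t - K * real k * t\<^sup>2 \<le> mpoly_eval (peak_poly k K (near_facet k 0 s)) (near_facet k t s)"
proof -
  have "(\<Sum>l\<in>{1..k - 1}. (near_facet k t s l - near_facet k 0 s l)\<^sup>2) \<le> (\<Sum>l\<in>{1..k - 1}. t\<^sup>2)"
    by (intro sum_mono) (auto simp: near_facet_def)
  also have "\<dots> \<le> real k * t\<^sup>2" by (simp add: mult_right_mono)
  finally have "K * (\<Sum>l\<in>{1..k - 1}. (near_facet k t s l - near_facet k 0 s l)\<^sup>2) \<le> K * (real k * t\<^sup>2)"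
    using assms by (intro mult_left_mono)
  moreover have "near_facet k t s 1 = t" using assms by (auto simp: near_facet_def)
  ultimately show ?thesis unfolding mpoly_eval_peak_poly by (simp add: mult.assoc)
qed


section \<open>Slopes at the facet\<close>

text \<open>Continuity of \<open>f 0\<close> is included to make the predicate closed under products.\<close>

definition continuous_slope :: "(real \<Rightarrow> real \<Rightarrow> real) \<Rightarrow> bool" where
  "continuous_slope f \<longleftrightarrow> continuous_on UNIV (f 0) \<and>
    (\<exists>D. continuous_on UNIV D \<and> (\<forall>s. ((\<lambda>t. f t s) has_real_derivative D s) (at 0)))"

lemma continuous_slope_const: "continuous_slope (\<lambda>t s. c)"
  unfolding continuous_slope_def by (auto intro!: exI[of _ "\<lambda>_. 0"] continuous_intros)

lemma continuous_slope_add: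
  assumes "continuous_slope f" "continuous_slope g"
  shows "continuous_slope (\<lambda>t s. f t s + g t s)"
proof -
  from assms obtain D E where "continuous_on UNIV D" "continuous_on UNIV E"
    "\<And>s. ((\<lambda>t. f t s) has_real_derivative D s) (at 0)"
    "\<And>s. ((\<lambda>t. g t s) has_real_derivative E s) (at 0)"
    unfolding continuous_slope_def by blast
  with assms show ?thesis unfolding continuous_slope_def
    by (auto intro!: exI[of _ "\<lambda>s. D s + E s"] continuous_on_add DERIV_add)
qed

lemma continuous_slope_mult:
  assumes "continuous_slope f" "continuous_slope g"
  shows "continuous_slope (\<lambda>t s. f t s * g t s)"
proof -
  from assms obtain D E where "continuous_on UNIV D" "continuous_on UNIV E"
    "\<And>s. ((\<lambda>t. f t s) has_real_derivative D s) (at 0)"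
    "\<And>s. ((\<lambda>t. g t s) has_real_derivative E s) (at 0)"
    unfolding continuous_slope_def by blast
  with assms show ?thesis unfolding continuous_slope_def
    by (auto intro!: exI[of _ "\<lambda>s. D s * g 0 s + E s * f 0 s"] continuous_on_add continuous_on_mult
        DERIV_mult)
qed

lemma continuous_slope_power: "continuous_slope f \<Longrightarrow> continuous_slope (\<lambda>t s. f t s ^ n)"
  by (induction n) (auto intro: continuous_slope_const continuous_slope_mult)

lemma continuous_slope_sum:
  "(\<And>a. a \<in> A \<Longrightarrow> continuous_slope (f a)) \<Longrightarrow> continuous_slope (\<lambda>t s. \<Sum>a\<in>A. f a t s)"
  by (induction A rule: infinite_finite_induct)
    (auto intro: continuous_slope_const continuous_slope_add)

lemma continuous_slope_prod:
  "(\<And>a. a \<in> A \<Longrightarrow> continuous_slope (f a)) \<Longrightarrow> continuous_slope (\<lambda>t s. \<Prod>a\<in>A. f a t s)"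
  by (induction A rule: infinite_finite_induct)
    (auto intro: continuous_slope_const continuous_slope_mult)

lemma continuous_slope_near_facet: "continuous_slope (\<lambda>t s. near_facet k t s i)"
proof -
  have t: "continuous_slope (\<lambda>t s. t)"
    unfolding continuous_slope_def by (auto intro!: exI[of _ "\<lambda>_. 1"] derivative_eq_intros)
  have s: "continuous_slope (\<lambda>t s. s)"
    unfolding continuous_slope_def by (auto intro!: exI[of _ "\<lambda>_. 0"] derivative_eq_intros)
  have r: "continuous_slope (\<lambda>t s. 1 - t - s)"
    unfolding continuous_slope_def
    by (auto intro!: exI[of _ "\<lambda>_. - 1"] derivative_eq_intros continuous_intros)
  show ?thesis
    unfolding near_facet_def restrict_def
    by (cases "i \<in> {1..k - 1}"; cases "i = 1"; cases "i = 2"; cases "i = 3")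
      (auto simp: t s r continuous_slope_const)
qed

lemma continuous_slope_mpoly_eval: "continuous_slope (\<lambda>t s. mpoly_eval P (near_facet k t s))"
  unfolding mpoly_eval_def
  by (intro continuous_slope_sum continuous_slope_mult continuous_slope_const
      continuous_slope_prod continuous_slope_power continuous_slope_near_facet)

lemma derivative_ge_of_quadratic_bound:
  fixes h :: "real \<Rightarrow> real"
  assumes h: "(h has_real_derivative D) (at 0)" "h 0 = 0"
    and e: "0 < e" and bound: "\<And>t. 0 < t \<Longrightarrow> t < e \<Longrightarrow> a * t - C * t\<^sup>2 \<le> h t"
  shows "a \<le> D"
proof (rule tendsto_le)
  show "((\<lambda>t. h t / t) \<longlongrightarrow> D) (at_right 0)"
    using h by (auto simp: has_field_derivative_iff intro: tendsto_mono[OF at_le])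
  have "((\<lambda>t. a - C * t) \<longlongrightarrow> a - C * 0) (at_right 0)"
    by (intro tendsto_intros)
  then show "((\<lambda>t. a - C * t) \<longlongrightarrow> a) (at_right 0)" by simp
  have "\<forall>\<^sub>F t in at_right 0. t \<in> {0<..<e}" using e by (rule eventually_at_right_real)
  then show "\<forall>\<^sub>F t in at_right 0. a - C * t \<le> h t / t"
    by eventually_elim (use bound in \<open>auto simp: field_simps power2_eq_square\<close>)
qed simp


section \<open>Nonexistence of a largest minorant\<close>

theorem theorem3p6:
  fixes k :: nat
  assumes "k \<ge> 3"
  shows "\<not> (\<exists>P\<in>minorants k. \<forall>Q\<in>minorants k. \<forall>p\<in>A_simplex k. mpoly_eval Q p \<le> mpoly_eval P p)"
proof
  assume "\<exists>P\<in>minorants k. \<forall>Q\<in>minorants k. \<forall>p\<in>A_simplex k. mpoly_eval Q p \<le> mpoly_eval P p"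
  then obtain P where P: "P \<in> minorants k"
    and largest: "\<And>Q p. Q \<in> minorants k \<Longrightarrow> p \<in> A_simplex k \<Longrightarrow> mpoly_eval Q p \<le> mpoly_eval P p"
    by blast
  define g where "g t s = mpoly_eval P (near_facet k t s)" for t s
  have P_le: "mpoly_eval P p \<le> renewal_mass k p n" if "p \<in> A_simplex k" "1 \<le> n" for p n
    using P that min_mass_le[of n k p] by (fastforce simp: minorants_iff)
  have zero: "0 \<in> minorants k"
    by (auto simp: minorants_iff polys_upto_0 intro: min_mass_ge renewal_mass_nonneg)
  have g_facet: "g 0 s = 0" if "0 \<le> s" "s \<le> 1" for s
  proof -
    have A: "near_facet k 0 s \<in> A_simplex k" using assms that by (intro near_facet_in_A_simplex) auto
    have "g 0 s \<le> near_facet k 0 s 1"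
      using P_le[OF A, of 1] renewal_mass_1[OF assms A] by (simp add: g_def)
    also have "\<dots> = 0" using assms by (simp add: near_facet_def)
    finally show ?thesis using largest[OF zero A] by (simp add: g_def)
  qed
  obtain D where D_cont: "continuous_on UNIV D"
    and D: "\<And>s. ((\<lambda>t. g t s) has_real_derivative D s) (at 0)"
    using continuous_slope_mpoly_eval[of P k] unfolding continuous_slope_def g_def by blast
  have D_ge: "1 \<le> D s" if s: "0 < s" "s < 1" for s
  proof -
    obtain K where K: "0 \<le> K" "peak_poly k K (near_facet k 0 s) \<in> minorants k"
      using peak_poly_in_minorants[OF assms s] .
    have "1 * t - (K * real k) * t\<^sup>2 \<le> g t s" if "0 < t" "t < 1 - s" for t
    proof -
      have "near_facet k t s \<in> A_simplex k"
        using assms s that by (intro near_facet_in_A_simplex) auto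
      then show ?thesis
        using largest[OF K(2)] mpoly_eval_peak_poly_near_facet[OF assms K(1), of t s]
        unfolding g_def by fastforce
    qed
    then show ?thesis
      using derivative_ge_of_quadratic_bound[OF D, of s "1 - s" 1 "K * real k"] g_facet[of s] s by simp
  qed
  have "1 \<le> D 0"
  proof (rule tendsto_lowerbound)
    have "isCont D 0" using D_cont by (simp add: continuous_on_eq_continuous_at)
    then show "(D \<longlongrightarrow> D 0) (at_right 0)"
      by (auto simp: isCont_def intro: tendsto_mono[OF at_le])
    have "\<forall>\<^sub>F s in at_right 0. s \<in> {0<..<1::real}" by (rule eventually_at_right_real) simp
    then show "\<forall>\<^sub>F s in at_right 0. 1 \<le> D s" by eventually_elim (simp add: D_ge)
  qed simp
  moreover have "0 \<le> - D 0"
  proof (rule derivative_ge_of_quadratic_bound)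
    show "((\<lambda>t. - g t 0) has_real_derivative - D 0) (at 0)" by (intro DERIV_minus D)
    show "- g 0 0 = 0" using g_facet[of 0] by simp
    fix t :: real assume t: "0 < t" "t < 1"
    then have A: "near_facet k t 0 \<in> A_simplex k"
      using assms by (intro near_facet_in_A_simplex) auto
    have "g t 0 \<le> (near_facet k t 0 1)\<^sup>2 + near_facet k t 0 2"
      using P_le[OF A, of 2] renewal_mass_2[OF assms A] by (simp add: g_def)
    also have "\<dots> = t\<^sup>2" using assms by (auto simp: near_facet_def)
    finally show "0 * t - 1 * t\<^sup>2 \<le> - g t 0" by simp
  qed simp
  ultimately show False by simp
qed

end
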